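(* Let $\mathcal{H}$ be a nonzero real Hilbert space, and let $K_1$ and $K_2$ be nonempty closed convex cones in $\mathcal{H}$. Assume that at least one of the following holds: (i) $c_0(K_1,-K_2)<1$. (ii) $\sup\{\langle P_{K_1}x,\ P_{(-K_2)}P_{K_1}x\rangle : x\in\mathbf{S}_{\mathcal{H}}\}<1$. (iii) $d(K_1\cap\mathbf{S}_{\mathcal{H}},\ -K_2\cap\mathbf{S}_{\mathcal{H}})>0$. (iv) $\inf\left\{\frac{\|x+y\|}{\|x\|+\|y\|} : x\in K_1,\ y\in K_2,\ (x,y)\neq(0,0)\right\}>0$. (v) There is a finite-dimensional linear subspace $\mathcal{K}$ of $\mathcal{H}$ such that $K_1\subseteq\mathcal{K}$ or $K_2\subseteq\mathcal{K}$, and $K_1\cap(-K_2)=\{0\}$. Then $K_1+K_2$ is closed.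
   Context: $\mathbf{B}_{\mathcal{H}}=\{x\in\mathcal{H}:\|x\|\le 1\}$ and $\mathbf{S}_{\mathcal{H}}=\{x\in\mathcal{H}:\|x\|=1\}$. A set $K\subseteq\mathcal{H}$ is a cone if $K=\mathbb{R}_{++}K$, where $\mathbb{R}_{++}=\{\lambda\in\mathbb{R}:\lambda>0\}$. For a nonempty closed convex set $A$, $P_A$ is the projector (nearest-point map) onto $A$. $d(A,B):=\inf\{\|x-y\| : x\in A,\ y\in B\}$ (with infimum over the empty set equal to $+\infty$). For nonempty closed convex cones $K_1,K_2$, the cosine of the minimal angle between them is $$c_0(K_1,K_2):=\sup\{\langle x,y\rangle : x\in K_1\cap\mathbf{B}_{\mathcal{H}},\ y\in K_2\cap\mathbf{B}_{\mathcal{H}}\}.$$ *)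

theory Defs
  imports "HOL-Analysis.Analysis"
begin

text \<open>
  A real Hilbert space is a type of sort \<open>{real_inner, complete_space}\<close>.
  On sets, \<open>- K\<close> is the complement in HOL, so the reflected cone is always written
  \<open>uminus ` K\<close>; the Minkowski sum \<open>K1 + K2\<close> is the one of \<open>HOL-Library.Set_Algebras\<close>.
\<close>

text \<open>The library predicate \<open>cone\<close> also demands closure under the scalar \<open>0\<close>;
  here only strictly positive scalars are involved, i.e. \<open>K\<close> equals its own positive scalings.\<close>

definition is_cone :: "'a::real_vector set \<Rightarrow> bool" where
  "is_cone K \<longleftrightarrow> K = {c *\<^sub>R x | c x. 0 < c \<and> x \<in> K}"

definition closed_convex_cone :: "'a::real_normed_vector set \<Rightarrow> bool" where
  "closed_convex_cone K \<longleftrightarrow> K \<noteq> {} \<and> closed K \<and> convex K \<and> is_cone K"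

text \<open>Same formula as the library's \<open>closest_point\<close>, whose type is restricted to
  \<open>heine_borel\<close> and hence to finite dimension.\<close>

definition projector :: "'a::real_inner set \<Rightarrow> 'a \<Rightarrow> 'a" where
  "projector A x = (SOME p. p \<in> A \<and> (\<forall>y\<in>A. dist x p \<le> dist x y))"

text \<open>Extended-real valued, so that the distance to the empty set is \<open>\<infinity>\<close>
  (the library's \<open>setdist\<close> returns \<open>0\<close> in that case).\<close>

definition set_distance :: "'a::real_normed_vector set \<Rightarrow> 'a set \<Rightarrow> ereal" where
  "set_distance A B = Inf {ereal (norm (x - y)) | x y. x \<in> A \<and> y \<in> B}"

text \<open>For nonempty closed cones the set below contains \<open>0\<close> and is bounded above by \<open>1\<close>,
  so the real supremum is the intended one.\<close>

definition cos_min_angle :: "'a::real_inner set \<Rightarrow> 'a set \<Rightarrow> real" where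
  "cos_min_angle K1 K2 = Sup {x \<bullet> y | x y. x \<in> K1 \<inter> cball 0 1 \<and> y \<in> K2 \<inter> cball 0 1}"

definition finite_dim_subspace :: "'a::real_vector set \<Rightarrow> bool" where
  "finite_dim_subspace V \<longleftrightarrow> subspace V \<and> (\<exists>B. finite B \<and> span B = V)"

end

theory Submission
  imports Defs
begin

text \<open>
  Each of the conditions yields some \<open>\<delta> > 0\<close> with \<open>\<delta> \<parallel>x\<parallel> \<le> \<parallel>x + y\<parallel>\<close> for all \<open>x\<close> in one cone and
  \<open>y\<close> in the other. If \<open>z\<close> is in the closure of the sum, then the approximate solutions
  \<open>x\<close> of \<open>\<parallel>x + y - z\<parallel> \<le> 1 / n\<close> thus form decreasing bounded convex sets. Their closures
  have a common point \<open>x\<close>, a substitute for weak compactness which follows from the parallelogram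
  law, and \<open>z - x\<close> belongs to the second cone.
\<close>

section \<open>Nested convex sets and nearest points in Hilbert space\<close>

text \<open>The distances \<open>d n\<close> from the origin to \<open>C n\<close> increase to a
  finite limit \<open>L\<close>. Two points of \<open>D n\<close> have norm barely above
  \<open>L\<close>, while their midpoint has norm at least \<open>d n\<close>, so the parallelogram
  law forces them together. The diameters of the \<open>D n\<close> thus tend to 0, and completeness
  gives a common point.\<close>

lemma nested_closed_convex_bounded:
  fixes C :: "nat \<Rightarrow> 'a::{real_inner, complete_space} set"
  assumes closed: "\<And>n. closed (C n)" and convex: "\<And>n. convex (C n)"
    and nonempty: "\<And>n. C n \<noteq> {}" and decreasing: "\<And>m n. m \<le> n \<Longrightarrow> C n \<subseteq> C m"
    and bounded: "bounded (C 0)"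
  obtains a where "\<And>n. a \<in> C n"
proof -
  define d where "d n = infdist 0 (C n)" for n
  define L where "L = (SUP n. d n)"
  define D where "D n = C n \<inter> cball 0 (L + inverse (real (Suc n)))" for n
  obtain R where R: "\<And>x. x \<in> C 0 \<Longrightarrow> norm x \<le> R"
    using bounded by (auto simp: bounded_iff)
  have d_le: "d n \<le> norm x" if "x \<in> C n" for n x
    using infdist_le[OF that, of 0] by (simp add: d_def)
  have d_nonneg: "0 \<le> d n" for n
    by (simp add: d_def infdist_nonneg)
  have "d n \<le> R" for n
    using nonempty[of n] decreasing[of 0 n] R d_le by (meson all_not_in_conv le0 order_trans subsetD)
  then have bdd: "bdd_above (range d)"
    by (intro bdd_aboveI[of _ R]) auto
  have d_le_L: "d n \<le> L" for n
    unfolding L_def by (intro cSUP_upper bdd) simp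
  have d_mono: "d m \<le> d n" if "m \<le> n" for m n
    unfolding d_def by (intro infdist_mono decreasing that nonempty)
  have "D n \<noteq> {}" for n
  proof -
    have "(INF x\<in>C n. dist 0 x) < L + inverse (real (Suc n))"
      using d_le_L[of n] nonempty[of n] by (simp add: d_def infdist_notempty add_strict_increasing2 le_less_trans)
    then obtain x where "x \<in> C n" "dist 0 x < L + inverse (real (Suc n))"
      using nonempty[of n] by (subst (asm) cINF_less_iff) (auto intro: bdd_belowI[of _ 0])
    then show ?thesis
      by (auto simp: D_def)
  qed
  moreover have "closed (D n)" for n
    unfolding D_def by (intro closed_Int closed closed_cball)
  moreover have "D n \<subseteq> D m" if "m \<le> n" for m n
  proof -
    have "inverse (real (Suc n)) \<le> inverse (real (Suc m))"
      using that by (simp add: field_simps)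
    then show ?thesis
      unfolding D_def by (intro Int_mono subset_cball decreasing that) auto
  qed
  moreover have "\<exists>n. \<forall>x\<in>D n. \<forall>y\<in>D n. dist x y < e" if "e > 0" for e
  proof -
    have L: "0 \<le> L"
      by (rule order_trans[OF d_nonneg d_le_L])
    \<comment> \<open>The final estimate below is \<open>4 * (\<eta> * (4 * L + 1))\<close>; this
      choice makes it at most half of \<open>e\<^sup>2\<close>. The cap at 1 serves to replace
      \<eta> * \<eta> by \<eta>.\<close>
    define \<eta> where "\<eta> = min 1 (e\<^sup>2 / (8 * (4 * L + 1)))"
    have \<eta>: "0 < \<eta>" "\<eta> \<le> 1"
      using L \<open>e > 0\<close> by (auto simp: \<eta>_def)
    have "\<eta> \<le> e\<^sup>2 / (8 * (4 * L + 1))"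
      by (simp add: \<eta>_def)
    then have "8 * (\<eta> * (4 * L + 1)) \<le> e\<^sup>2"
      using L by (simp add: field_simps)
    moreover have "0 < e\<^sup>2"
      using \<open>e > 0\<close> by simp
    ultimately have small: "4 * (\<eta> * (4 * L + 1)) < e\<^sup>2"
      by linarith
    have "L - \<eta> < L"
      using \<eta> by simp
    then obtain N where N: "L - \<eta> < d N"
      using less_cSUP_iff[OF _ bdd] unfolding L_def by blast
    obtain M where M: "inverse (real (Suc M)) < \<eta>"
      using reals_Archimedean \<eta>(1) by blast
    define n where "n = max N M"
    have "inverse (real (Suc n)) \<le> inverse (real (Suc M))"
      by (simp add: n_def field_simps)
    then have n_inv: "inverse (real (Suc n)) \<le> \<eta>"
      using M by linarith
    have dn: "L - \<eta> \<le> d n"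
      using N d_mono[of N n] by (simp add: n_def)
    have "dist x y < e" if xy: "x \<in> D n" "y \<in> D n" for x y
    proof -
      have nx: "norm x \<le> L + \<eta>" "norm y \<le> L + \<eta>"
        using xy n_inv by (auto simp: D_def)
      have "(1/2) *\<^sub>R x + (1/2) *\<^sub>R y \<in> C n"
        using convexD[OF convex[of n], of x y "1/2" "1/2"] xy by (auto simp: D_def)
      then have "d n \<le> norm ((1/2) *\<^sub>R (x + y))"
        using d_le by (simp add: scaleR_add_right)
      then have mid: "(2 * d n)\<^sup>2 \<le> (norm (x + y))\<^sup>2"
        using d_nonneg[of n] by (intro power_mono) auto
      have sq: "(norm x)\<^sup>2 \<le> (L + \<eta>)\<^sup>2" "(norm y)\<^sup>2 \<le> (L + \<eta>)\<^sup>2"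
        using nx by (simp_all add: power_mono)
      have "(norm (x - y))\<^sup>2 = 2 * (norm x)\<^sup>2 + 2 * (norm y)\<^sup>2 - (norm (x + y))\<^sup>2"
        by (simp add: power2_norm_eq_inner inner_simps inner_commute)
      also have "\<dots> \<le> 2 * (L + \<eta>)\<^sup>2 + 2 * (L + \<eta>)\<^sup>2 - (2 * d n)\<^sup>2"
        using sq mid by linarith
      \<comment> \<open>Factoring the difference of the squares of \<open>L\<close> and
        \<open>d n\<close> brings in \<open>L - d n\<close>, which is at most \<eta>.\<close>
      also have "\<dots> = 4 * (2 * L * \<eta> + \<eta> * \<eta> + (L - d n) * (L + d n))"
        by (simp add: power2_eq_square algebra_simps)
      also have "\<dots> \<le> 4 * (2 * L * \<eta> + \<eta> * 1 + \<eta> * (L + L))"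
        using \<eta> dn d_le_L[of n] d_nonneg[of n] L
        by (intro mult_left_mono add_mono mult_mono) auto
      also have "\<dots> = 4 * (\<eta> * (4 * L + 1))"
        by (simp add: algebra_simps)
      also have "\<dots> < e\<^sup>2"
        by (rule small)
      finally show ?thesis
        using \<open>e > 0\<close> by (simp add: dist_norm power2_less_imp_less)
    qed
    then show ?thesis
      by blast
  qed
  ultimately obtain a where "\<And>n. a \<in> D n"
    using decreasing_closed_nest[of D] by metis
  then show ?thesis
    using that by (auto simp: D_def)
qed

text \<open>The balls around \<open>x\<close> with radii decreasing to the distance from
  \<open>A\<close> cut out nested bounded closed convex subsets of \<open>A\<close>; a common point
  attains the distance.\<close>

lemma closest_point_exists_hilbert:
  fixes A :: "'a::{real_inner, complete_space} set"
  assumes "A \<noteq> {}" "closed A" "convex A"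
  obtains p where "p \<in> A" "\<forall>y\<in>A. dist x p \<le> dist x y"
proof -
  define C where "C n = A \<inter> cball x (infdist x A + inverse (real (Suc n)))" for n
  have "C n \<noteq> {}" for n
  proof -
    have "(INF y\<in>A. dist x y) < infdist x A + inverse (real (Suc n))"
      using assms(1) by (simp add: infdist_notempty)
    then obtain y where "y \<in> A" "dist x y < infdist x A + inverse (real (Suc n))"
      using assms(1) by (subst (asm) cINF_less_iff) (auto intro: bdd_belowI[of _ 0])
    then show ?thesis
      by (auto simp: C_def)
  qed
  moreover have "C n \<subseteq> C m" if "m \<le> n" for m n
  proof -
    have "inverse (real (Suc n)) \<le> inverse (real (Suc m))"
      using that by (simp add: field_simps)
    then show ?thesis
      unfolding C_def by (intro Int_mono subset_cball) auto
  qed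
  ultimately obtain p where p: "\<And>n. p \<in> C n"
    using assms nested_closed_convex_bounded[of C]
    by (metis C_def bounded_Int bounded_cball closed_Int closed_cball convex_Int convex_cball)
  have "dist x p \<le> infdist x A"
  proof (rule field_le_epsilon)
    fix e :: real assume "0 < e"
    then obtain n where "inverse (real (Suc n)) < e"
      using reals_Archimedean by blast
    then show "dist x p \<le> infdist x A + e"
      using p[of n] by (simp add: C_def)
  qed
  then show ?thesis
    using that[of p] p[of 0] infdist_le[of _ A x] by (force simp: C_def)
qed

section \<open>Projectors and closed convex cones\<close>

lemma projector_closest:
  fixes A :: "'a::{real_inner, complete_space} set"
  assumes "A \<noteq> {}" "closed A" "convex A"
  shows "projector A x \<in> A \<and> (\<forall>y\<in>A. dist x (projector A x) \<le> dist x y)"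
  unfolding projector_def by (rule someI_ex) (meson closest_point_exists_hilbert assms)

lemma projector_id:
  assumes "x \<in> A"
  shows "projector A x = x"
proof -
  have "projector A x \<in> A \<and> (\<forall>y\<in>A. dist x (projector A x) \<le> dist x y)"
    unfolding projector_def by (rule someI[of _ x]) (use assms in auto)
  then show ?thesis
    using assms by force
qed

lemma is_cone_scaleR: "is_cone K \<Longrightarrow> x \<in> K \<Longrightarrow> 0 < c \<Longrightarrow> c *\<^sub>R x \<in> K"
  unfolding is_cone_def by blast

lemma closed_convex_cone_scaleR:
  "closed_convex_cone K \<Longrightarrow> x \<in> K \<Longrightarrow> 0 < c \<Longrightarrow> c *\<^sub>R x \<in> K"
  by (auto simp: closed_convex_cone_def is_cone_scaleR)

text \<open>Cones are only closed under strictly positive scalars, so the origin is reached as the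
  limit of shrinking multiples of a point.\<close>

lemma closed_convex_cone_zero:
  assumes "closed_convex_cone K"
  shows "0 \<in> K"
proof -
  obtain x where x: "x \<in> K"
    using assms by (auto simp: closed_convex_cone_def)
  have "(\<lambda>n. inverse (real (Suc n)) *\<^sub>R x) \<longlonglongrightarrow> 0 *\<^sub>R x"
    by (intro tendsto_scaleR LIMSEQ_inverse_real_of_nat tendsto_const)
  moreover have "inverse (real (Suc n)) *\<^sub>R x \<in> K" for n
    by (intro closed_convex_cone_scaleR[OF assms x]) simp
  ultimately show ?thesis
    using assms closed_sequentially[of K "\<lambda>n. inverse (real (Suc n)) *\<^sub>R x" 0]
    by (simp add: closed_convex_cone_def)
qed

lemma closed_convex_cone_uminus:
  assumes "closed_convex_cone K"
  shows "closed_convex_cone (uminus ` K)"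
proof -
  have K: "K = {c *\<^sub>R x | c x. 0 < c \<and> x \<in> K}"
    using assms by (simp add: closed_convex_cone_def is_cone_def)
  have "uminus ` K = {c *\<^sub>R x | c x. 0 < c \<and> x \<in> uminus ` K}"
    by (subst K) (force simp: image_iff)
  then show ?thesis
    using assms closed_negations[of K] convex_negations[of K]
    by (simp add: closed_convex_cone_def is_cone_def)
qed

text \<open>The variational inequality for the nearest point \<open>?p\<close>, tested at
  \<open>2 *\<^sub>R ?p\<close> and at 0, gives both inequalities between the two sides:
  \<open>x - ?p\<close> is orthogonal to \<open>?p\<close>.\<close>

lemma projector_cone_orthogonal:
  fixes K :: "'a::{real_inner, complete_space} set"
  assumes K: "closed_convex_cone K"
  shows "x \<bullet> projector K x = projector K x \<bullet> projector K x"
proof -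
  let ?p = "projector K x"
  have p: "?p \<in> K" "\<forall>y\<in>K. dist x ?p \<le> dist x y"
    using projector_closest[of K x] K by (auto simp: closed_convex_cone_def)
  have var: "(x - ?p) \<bullet> (y - ?p) \<le> 0" if "y \<in> K" for y
    using any_closest_point_dot[OF _ _ p(1) that p(2)] K by (auto simp: closed_convex_cone_def)
  have "2 *\<^sub>R ?p \<in> K"
    by (intro closed_convex_cone_scaleR[OF K p(1)]) simp
  from var[OF this] var[OF closed_convex_cone_zero[OF K]] show ?thesis
    by (simp add: inner_simps inner_commute)
qed

text \<open>By this orthogonality the variational inequality loses its term in \<open>?p\<close> and
  says that \<open>x - ?p\<close> lies in the polar cone of \<open>K\<close>.\<close>

lemma projector_cone_polar:
  fixes K :: "'a::{real_inner, complete_space} set"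
  assumes K: "closed_convex_cone K" and "y \<in> K"
  shows "x \<bullet> y \<le> projector K x \<bullet> y"
proof -
  let ?p = "projector K x"
  have p: "?p \<in> K" "\<forall>y\<in>K. dist x ?p \<le> dist x y"
    using projector_closest[of K x] K by (auto simp: closed_convex_cone_def)
  have "(x - ?p) \<bullet> (y - ?p) \<le> 0"
    using any_closest_point_dot[OF _ _ p(1) assms(2) p(2)] K by (auto simp: closed_convex_cone_def)
  then show ?thesis
    using projector_cone_orthogonal[OF K, of x] by (simp add: inner_simps inner_commute)
qed

lemma norm_projector_cone_le:
  fixes K :: "'a::{real_inner, complete_space} set"
  assumes "closed_convex_cone K"
  shows "norm (projector K x) \<le> norm x"
proof -
  have "norm (projector K x) * norm (projector K x) \<le> norm x * norm (projector K x)"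
    using projector_cone_orthogonal[OF assms, of x] norm_cauchy_schwarz[of x "projector K x"]
    by (simp add: power2_norm_eq_inner flip: power2_eq_square)
  then show ?thesis
    by (cases "projector K x = 0") auto
qed

section \<open>Closedness of sums from norm and angle bounds\<close>

lemma closed_sum_if_norm_bound:
  fixes A B :: "'a::{real_inner, complete_space} set"
  assumes "closed A" "convex A" "closed B" "convex B" "0 < \<delta>"
    and bound: "\<And>x y. x \<in> A \<Longrightarrow> y \<in> B \<Longrightarrow> \<delta> * norm x \<le> norm (x + y)"
  shows "closed (A + B)"
proof -
  have "z \<in> A + B" if z: "z \<in> closure (A + B)" for z
  proof -
    \<comment> \<open>\<open>E n\<close> holds the \<open>A\<close>-components of approximate
      decompositions of \<open>z\<close>. Passing to closures in \<open>C n\<close> avoids a proof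
      that \<open>E n\<close> is closed.\<close>
    define E where "E n = {x \<in> A. \<exists>y\<in>B. norm (x + y - z) \<le> inverse (real (Suc n))}" for n
    define C where "C n = closure (E n)" for n
    have ne: "C n \<noteq> {}" for n
    proof -
      obtain w where "w \<in> A + B" "dist w z < inverse (real (Suc n))"
        using z unfolding closure_approachable by (metis inverse_positive_iff_positive of_nat_0_less_iff zero_less_Suc)
      then have "E n \<noteq> {}"
        by (force simp: E_def set_plus_def dist_norm)
      then show ?thesis
        by (simp add: C_def)
    qed
    have "convex (E n)" for n
    proof (rule convexI)
      fix x x' and u v :: real
      assume x: "x \<in> E n" "x' \<in> E n" and uv: "0 \<le> u" "0 \<le> v" "u + v = 1"
      obtain y y' where y: "y \<in> B" "norm (x + y - z) \<le> inverse (real (Suc n))"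
        and y': "y' \<in> B" "norm (x' + y' - z) \<le> inverse (real (Suc n))"
        using x by (auto simp: E_def)
      have "(u *\<^sub>R x + v *\<^sub>R x') + (u *\<^sub>R y + v *\<^sub>R y') - z
          = u *\<^sub>R (x + y - z) + v *\<^sub>R (x' + y' - z)"
        using uv(3) by (simp add: algebra_simps flip: scaleR_add_left)
      also have "norm \<dots> \<le> inverse (real (Suc n))"
        using convexD[OF convex_cball[of 0 "inverse (real (Suc n))"], of "x + y - z" "x' + y' - z" u v]
          y y' uv by simp
      finally show "u *\<^sub>R x + v *\<^sub>R x' \<in> E n"
        using x y(1) y'(1) uv assms(2,4) by (auto simp: E_def convex_def)
    qed
    then have "convex (C n)" for n
      by (simp add: C_def convex_closure)
    moreover have "C n \<subseteq> C m" if "m \<le> n" for m n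
    proof -
      have "inverse (real (Suc n)) \<le> inverse (real (Suc m))"
        using that by (simp add: field_simps)
      then have "E n \<subseteq> E m"
        unfolding E_def by (blast intro: order_trans)
      then show ?thesis
        by (simp add: C_def closure_mono)
    qed
    \<comment> \<open>The norm bound enters here: at \<open>n = 0\<close> the tolerance is 1, so
      \<open>x + y\<close> has norm at most \<open>norm z + 1\<close>, which controls
      \<open>x\<close> alone.\<close>
    moreover have "bounded (C 0)"
    proof -
      have "norm x \<le> (norm z + 1) / \<delta>" if x: "x \<in> E 0" for x
      proof -
        obtain y where y: "y \<in> B" "norm (x + y - z) \<le> 1"
          using x by (auto simp: E_def)
        have "\<delta> * norm x \<le> norm (x + y)"
          using x y by (intro bound) (auto simp: E_def)
        also have "\<dots> \<le> norm z + 1"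
          using norm_triangle_ineq[of "x + y - z" z] y(2) by simp
        finally show ?thesis
          using \<open>0 < \<delta>\<close> by (simp add: field_simps)
      qed
      then show ?thesis
        unfolding C_def by (intro bounded_closure) (auto simp: bounded_iff)
    qed
    ultimately obtain x where x: "\<And>n. x \<in> C n"
      using nested_closed_convex_bounded[of C] ne unfolding C_def by (metis closed_closure)
    have "E 0 \<subseteq> A"
      by (auto simp: E_def)
    then have "x \<in> A"
      using x[of 0] closure_minimal[OF _ \<open>closed A\<close>] by (auto simp: C_def)
    \<comment> \<open>Since \<open>x\<close> is only a limit of points of \<open>E n\<close>, half
      of \<open>e\<close> pays for replacing it by \<open>x'\<close> in \<open>E n\<close> and half
      for the tolerance of \<open>E n\<close>.\<close>
    moreover have "z - x \<in> closure B"
      unfolding closure_approachable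
    proof (intro allI impI)
      fix e :: real assume "0 < e"
      then obtain n where n: "inverse (real (Suc n)) < e / 2"
        using reals_Archimedean[of "e / 2"] by auto
      obtain x' where x': "x' \<in> E n" "dist x' x < e / 2"
        using x[of n] \<open>0 < e\<close> unfolding C_def closure_approachable by (meson half_gt_zero)
      then obtain y where y: "y \<in> B" "norm (x' + y - z) \<le> inverse (real (Suc n))"
        by (auto simp: E_def)
      have "y - (z - x) = (x' + y - z) - (x' - x)"
        by simp
      then have "dist y (z - x) \<le> norm (x' + y - z) + norm (x' - x)"
        unfolding dist_norm by (metis norm_triangle_ineq4)
      also have "\<dots> < e"
        using y n x' by (simp add: dist_norm)
      finally show "\<exists>y\<in>B. dist y (z - x) < e"
        using y(1) by blast
    qed
    then have "z - x \<in> B"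
      using \<open>closed B\<close> by simp
    ultimately show ?thesis
      using set_plus_intro[of x A "z - x" B] by simp
  qed
  then show ?thesis
    by (metis closure_subset closure_eq subsetI subset_antisym)
qed

text \<open>After expanding the squared norm of the sum, the worst case is
  \<open>norm y = c * norm x\<close>; completing the square in \<open>norm y\<close> shows
  this.\<close>

lemma norm_bound_if_angle_bound:
  fixes x y :: "'a::real_inner"
  assumes "- (x \<bullet> y) \<le> c * (norm x * norm y)"
  shows "(1 - c\<^sup>2) * (norm x)\<^sup>2 \<le> (norm (x + y))\<^sup>2"
proof -
  have "(norm (x + y))\<^sup>2 = (norm x)\<^sup>2 + (norm y)\<^sup>2 + 2 * (x \<bullet> y)"
    using dot_norm[of x y] by simp
  moreover have "0 \<le> (norm y - c * norm x)\<^sup>2"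
    by simp
  ultimately show ?thesis
    using assms by (simp add: power2_eq_square algebra_simps)
qed

text \<open>If \<open>c\<close> bounds the cosine of the angle between \<open>K1\<close> and the
  reflection of \<open>K2\<close>, the corresponding sine \<open>sqrt (1 - c\<^sup>2)\<close> serves
  as \<delta> in the norm bound.\<close>

lemma closed_sum_if_angle_bound:
  fixes K1 K2 :: "'a::{real_inner, complete_space} set"
  assumes "closed K1" "convex K1" "closed K2" "convex K2" "0 \<le> c" "c < 1"
    and "\<And>x y. x \<in> K1 \<Longrightarrow> y \<in> K2 \<Longrightarrow> - (x \<bullet> y) \<le> c * (norm x * norm y)"
  shows "closed (K1 + K2)"
proof (rule closed_sum_if_norm_bound)
  have "c\<^sup>2 < 1"
    using assms(5,6) by (simp add: abs_square_less_1)
  then show "0 < sqrt (1 - c\<^sup>2)"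
    by simp
  fix x y assume "x \<in> K1" "y \<in> K2"
  then have "sqrt ((1 - c\<^sup>2) * (norm x)\<^sup>2) \<le> sqrt ((norm (x + y))\<^sup>2)"
    by (intro real_sqrt_le_mono norm_bound_if_angle_bound assms)
  then show "sqrt (1 - c\<^sup>2) * norm x \<le> norm (x + y)"
    by (simp add: real_sqrt_mult)
qed (use assms in auto)

text \<open>Both sides are positively homogeneous in \<open>x\<close> and in \<open>y\<close>, so
  normalizing reduces the claim to unit vectors.\<close>

lemma angle_bound_if_unit:
  fixes K1 K2 :: "'a::real_inner set"
  assumes "closed_convex_cone K1" "closed_convex_cone K2"
    and unit: "\<And>u v. u \<in> K1 \<Longrightarrow> v \<in> K2 \<Longrightarrow> norm u = 1 \<Longrightarrow> norm v = 1 \<Longrightarrow> - (u \<bullet> v) \<le> c"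
    and "x \<in> K1" "y \<in> K2"
  shows "- (x \<bullet> y) \<le> c * (norm x * norm y)"
proof (cases "x = 0 \<or> y = 0")
  case False
  then have "- (((1 / norm x) *\<^sub>R x) \<bullet> ((1 / norm y) *\<^sub>R y)) \<le> c"
    using assms by (intro unit closed_convex_cone_scaleR) auto
  then show ?thesis
    using False by (simp add: field_simps)
qed auto

section \<open>The finite-dimensional condition\<close>

text \<open>This supplies compactness inside an arbitrary ambient space. Adding a generator
  \<open>b\<close> splits a point orthogonally into a multiple of \<open>b\<close> and a point of
  \<open>span C\<close>; by Pythagoras neither part is longer than the point itself, so a sum of two
  compact sets covers the ball.\<close>

lemma compact_superset_span_cball:
  fixes C :: "'a::real_inner set"
  assumes "finite C" "pairwise orthogonal C"
  shows "\<exists>T. compact T \<and> span C \<inter> cball 0 R \<subseteq> T"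
  using assms
proof (induction rule: finite_induct)
  case empty
  then show ?case
    by (intro exI[of _ "{0}"]) auto
next
  case (insert b C)
  have "pairwise orthogonal C"
    using insert.prems by (rule pairwise_subset) blast
  then obtain T where T: "compact T" "span C \<inter> cball 0 R \<subseteq> T"
    using insert.IH by blast
  \<comment> \<open>For \<open>b = 0\<close> the quotient \<open>R / norm b\<close> is 0, so
    \<open>?I\<close> is \<open>{0}\<close> and still contains \<open>k *\<^sub>R b\<close>.\<close>
  let ?I = "(\<lambda>k. k *\<^sub>R b) ` {- (R / norm b)..R / norm b}"
  have "compact ?I"
    by (intro compact_continuous_image continuous_intros) auto
  moreover have "span (insert b C) \<inter> cball 0 R \<subseteq> {u + v | u v. u \<in> ?I \<and> v \<in> T}"
  proof
    fix x assume "x \<in> span (insert b C) \<inter> cball 0 R"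
    then obtain k where k: "x - k *\<^sub>R b \<in> span C" and x: "norm x \<le> R"
      by (auto simp: span_insert)
    define v where "v = x - k *\<^sub>R b"
    have "orthogonal b v"
      unfolding v_def
    proof (rule orthogonal_to_span[OF k])
      show "orthogonal b c" if "c \<in> C" for c
        using pairwiseD[OF insert.prems, of b c] insert.hyps(2) that by blast
    qed
    then have "(norm (k *\<^sub>R b + v))\<^sup>2 = (norm (k *\<^sub>R b))\<^sup>2 + (norm v)\<^sup>2"
      by (intro norm_add_Pythagorean) (simp add: orthogonal_clauses)
    then have "(norm (k *\<^sub>R b))\<^sup>2 \<le> (norm x)\<^sup>2" "(norm v)\<^sup>2 \<le> (norm x)\<^sup>2"
      by (simp_all add: v_def)
    note le = this[THEN power2_le_imp_le, OF norm_ge_zero]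
    have "k *\<^sub>R b \<in> ?I"
    proof (cases "b = 0")
      case False
      then have "\<bar>k\<bar> \<le> R / norm b"
        using le(1) x by (simp add: pos_le_divide_eq)
      then show ?thesis
        by (intro imageI) (simp add: abs_le_iff)
    qed auto
    moreover have "v \<in> T"
      using T(2) k le(2) x by (auto simp: v_def)
    moreover have "x = k *\<^sub>R b + v"
      by (simp add: v_def)
    ultimately show "x \<in> {u + v | u v. u \<in> ?I \<and> v \<in> T}"
      by blast
  qed
  ultimately show ?case
    by (intro exI[of _ "{u + v | u v. u \<in> ?I \<and> v \<in> T}"] conjI compact_sums T(1))
qed

text \<open>The unit vectors of \<open>K1\<close> form a compact set disjoint from the closed cone
  \<open>N\<close>, so their distance to \<open>N\<close> has a positive minimum. By homogeneity
  this minimum is the \<delta> of the norm bound.\<close>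

lemma closed_sum_if_finite_dim:
  fixes K1 K2 :: "'a::{real_inner, complete_space} set"
  assumes K1: "closed_convex_cone K1" and K2: "closed_convex_cone K2"
    and V: "finite_dim_subspace V" "K1 \<subseteq> V" and Int: "K1 \<inter> uminus ` K2 = {0}"
  shows "closed (K1 + K2)"
proof -
  obtain B where B: "finite B" "span B = V"
    using V(1) by (auto simp: finite_dim_subspace_def)
  then obtain C where C: "finite C" "span C = V" "pairwise orthogonal C"
    using basis_orthogonal[OF B(1)] by auto
  then obtain T where T: "compact T" "V \<inter> cball 0 1 \<subseteq> T"
    using compact_superset_span_cball[of C 1] by auto
  define S where "S = K1 \<inter> sphere 0 1"
  define N where "N = uminus ` K2"
  have N: "closed N" "N \<noteq> {}"
    using closed_convex_cone_uminus[OF K2] by (auto simp: N_def closed_convex_cone_def)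
  have "S \<subseteq> T"
    using T(2) V(2) by (force simp: S_def)
  moreover have "closed S"
    using K1 closed_Diff[OF closed_cball open_ball, of 0 1 0 1]
    unfolding S_def by (intro closed_Int) (auto simp: closed_convex_cone_def cball_diff_eq_sphere)
  ultimately have "compact S"
    using T(1) by (metis compact_Int_closed inf.absorb_iff2)
  \<comment> \<open>The set \<open>S\<close> is empty when \<open>K1\<close> is \<open>{0}\<close>;
    the value 1 then serves as \<delta>.\<close>
  have "\<exists>\<delta>>0. \<forall>u\<in>S. \<delta> \<le> infdist u N"
  proof (cases "S = {}")
    case False
    then obtain u where u: "u \<in> S" "\<forall>v\<in>S. infdist u N \<le> infdist v N"
      using continuous_attains_inf[OF \<open>compact S\<close> False continuous_on_infdist[OF continuous_on_id, of S N]]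
      by blast
    have "u \<notin> N"
    proof
      assume "u \<in> N"
      then have "u \<in> K1 \<inter> uminus ` K2"
        using u(1) unfolding S_def N_def by blast
      then have "u = 0"
        unfolding Int by simp
      with u(1) show False
        by (simp add: S_def)
    qed
    then have "0 < infdist u N"
      using N by (simp add: infdist_pos_not_in_closed)
    with u show ?thesis
      by blast
  qed (auto intro: exI[of _ 1])
  then obtain \<delta> where \<delta>: "0 < \<delta>" "\<And>u. u \<in> S \<Longrightarrow> \<delta> \<le> infdist u N"
    by blast
  show ?thesis
  proof (rule closed_sum_if_norm_bound)
    show "0 < \<delta>"
      by (rule \<delta>)
    fix x y assume x: "x \<in> K1" and y: "y \<in> K2"
    show "\<delta> * norm x \<le> norm (x + y)"
    proof (cases "x = 0")
      case False
      let ?c = "1 / norm x"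
      have "?c *\<^sub>R x \<in> S" "- (?c *\<^sub>R y) \<in> N"
        using False closed_convex_cone_scaleR[OF K1 x, of ?c] closed_convex_cone_scaleR[OF K2 y, of ?c]
        by (auto simp: S_def N_def)
      then have "\<delta> \<le> dist (?c *\<^sub>R x) (- (?c *\<^sub>R y))"
        by (rule order_trans[OF \<delta>(2) infdist_le])
      also have "\<dots> = norm (?c *\<^sub>R (x + y))"
        by (simp add: dist_norm scaleR_add_right)
      also have "\<dots> = norm (x + y) / norm x"
        by simp
      finally show ?thesis
        using False by (simp add: field_simps)
    qed auto
  qed (use K1 K2 in \<open>auto simp: closed_convex_cone_def\<close>)
qed

section \<open>Closedness under each of the five conditions\<close>

theorem corollary4p8:
  fixes K1 K2 :: "'a::{real_inner, complete_space} set"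
  assumes nonzero: "\<exists>x::'a. x \<noteq> 0"
    and K1: "closed_convex_cone K1"
    and K2: "closed_convex_cone K2"
    and conditions:
      "cos_min_angle K1 (uminus ` K2) < 1
       \<or> Sup {projector K1 x \<bullet> projector (uminus ` K2) (projector K1 x) | x. x \<in> sphere 0 1} < 1
       \<or> set_distance (K1 \<inter> sphere 0 1) (uminus ` K2 \<inter> sphere 0 1) > 0
       \<or> Inf {ereal (norm (x + y) / (norm x + norm y)) | x y.
               x \<in> K1 \<and> y \<in> K2 \<and> (x, y) \<noteq> (0, 0)} > 0
       \<or> ((\<exists>V. finite_dim_subspace V \<and> (K1 \<subseteq> V \<or> K2 \<subseteq> V)) \<and> K1 \<inter> uminus ` K2 = {0})"
  shows "closed (K1 + K2)"
proof -
  note cc = K1[unfolded closed_convex_cone_def] K2[unfolded closed_convex_cone_def]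
  define N where "N = uminus ` K2"
  have N: "closed_convex_cone N"
    unfolding N_def by (rule closed_convex_cone_uminus[OF K2])
  \<comment> \<open>Conditions (i) to (iii) all reduce to a cosine bound on unit vectors. It is
    replaced by \<open>max 0 c\<close> because \<open>closed_sum_if_angle_bound\<close> asks for a
    nonnegative constant.\<close>
  have angle: "closed (K1 + K2)"
    if "c < 1" and bound: "\<And>u w. u \<in> K1 \<Longrightarrow> w \<in> N \<Longrightarrow> norm u = 1 \<Longrightarrow> norm w = 1 \<Longrightarrow> u \<bullet> w \<le> c" for c
  proof (rule closed_sum_if_angle_bound)
    fix x y assume "x \<in> K1" "y \<in> K2"
    moreover have "- (u \<bullet> v) \<le> max 0 c" if "u \<in> K1" "v \<in> K2" "norm u = 1" "norm v = 1" for u v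
      using bound[of u "- v"] that by (simp add: N_def)
    ultimately show "- (x \<bullet> y) \<le> max 0 c * (norm x * norm y)"
      by (intro angle_bound_if_unit[OF K1 K2])
  qed (use cc that(1) in auto)
  consider
      (i) "cos_min_angle K1 N < 1"
    | (ii) "Sup {projector K1 x \<bullet> projector N (projector K1 x) | x. x \<in> sphere 0 1} < 1"
    | (iii) "0 < set_distance (K1 \<inter> sphere 0 1) (N \<inter> sphere 0 1)"
    | (iv) "0 < Inf {ereal (norm (x + y) / (norm x + norm y)) | x y.
               x \<in> K1 \<and> y \<in> K2 \<and> (x, y) \<noteq> (0, 0)}"
    | (v) V where "finite_dim_subspace V" "K1 \<subseteq> V \<or> K2 \<subseteq> V" "K1 \<inter> N = {0}"
    using conditions by (auto simp: N_def)
  then show ?thesis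
  proof cases
    case i
    let ?S = "{x \<bullet> y | x y. x \<in> K1 \<inter> cball 0 1 \<and> y \<in> N \<inter> cball 0 1}"
    have "x \<bullet> y \<le> 1" if "norm x \<le> 1" "norm y \<le> 1" for x y :: 'a
      using norm_cauchy_schwarz[of x y] mult_mono[OF that] by simp
    then have bdd: "bdd_above ?S"
      by (intro bdd_aboveI[of _ 1]) auto
    show ?thesis
    proof (rule angle[OF i])
      fix u w assume "u \<in> K1" "w \<in> N" "norm u = 1" "norm w = 1"
      then have "u \<bullet> w \<in> ?S"
        by force
      then show "u \<bullet> w \<le> cos_min_angle K1 N"
        unfolding cos_min_angle_def by (intro cSup_upper bdd)
    qed
  next
    case ii
    let ?S = "{projector K1 x \<bullet> projector N (projector K1 x) | x. x \<in> sphere 0 1}"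
    have "projector K1 x \<bullet> projector N (projector K1 x) \<le> 1" if "norm x = 1" for x
    proof -
      have 1: "norm (projector K1 x) \<le> 1"
        using norm_projector_cone_le[OF K1, of x] that by simp
      then have "norm (projector N (projector K1 x)) \<le> 1"
        by (rule order_trans[OF norm_projector_cone_le[OF N]])
      with 1 show ?thesis
        using norm_cauchy_schwarz[of "projector K1 x" "projector N (projector K1 x)"]
          mult_mono[of "norm (projector K1 x)" 1 "norm (projector N (projector K1 x))" 1] by simp
    qed
    then have bdd: "bdd_above ?S"
      by (intro bdd_aboveI[of _ 1]) auto
    show ?thesis
    proof (rule angle)
      \<comment> \<open>For a unit vector \<open>u\<close> of \<open>K1\<close> the element of
        \<open>?S\<close> at \<open>u\<close> is the square of \<open>norm (projector N u)\<close>,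
        and this norm bounds the cosine between \<open>u\<close> and any unit vector of
        \<open>N\<close>; hence the square root.\<close>
      show "sqrt (Sup ?S) < 1"
        using ii by simp
      fix u w assume u: "u \<in> K1" "norm u = 1" and w: "w \<in> N" "norm w = 1"
      have "u \<bullet> projector N u \<in> ?S"
        using u projector_id[OF u(1)] by force
      then have "u \<bullet> projector N u \<le> Sup ?S"
        by (intro cSup_upper bdd)
      then have "norm (projector N u) \<le> sqrt (Sup ?S)"
        by (simp add: projector_cone_orthogonal[OF N] norm_eq_sqrt_inner)
      moreover have "u \<bullet> w \<le> norm (projector N u) * norm w"
        by (rule order_trans[OF projector_cone_polar[OF N w(1)] norm_cauchy_schwarz])
      ultimately show "u \<bullet> w \<le> sqrt (Sup ?S)"
        using w by simp
    qed
  next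
    case iii
    \<comment> \<open>The distance is infinite when one of the cones is \<open>{0}\<close>, so a
      real number strictly below it is chosen.\<close>
    obtain \<delta> where \<delta>: "0 < ereal \<delta>" "ereal \<delta> < set_distance (K1 \<inter> sphere 0 1) (N \<inter> sphere 0 1)"
      using ereal_dense2[OF iii] by blast
    show ?thesis
    proof (rule angle)
      \<comment> \<open>For unit vectors the squared norm of \<open>u - w\<close> equals
        \<open>2 - 2 * (u \<bullet> w)\<close>, which turns a distance of at least \<delta> into
        this cosine bound.\<close>
      show "1 - \<delta>\<^sup>2 / 2 < 1"
        using \<delta>(1) by simp
      fix u w assume uw: "u \<in> K1" "w \<in> N" "norm u = 1" "norm w = 1"
      then have "set_distance (K1 \<inter> sphere 0 1) (N \<inter> sphere 0 1) \<le> ereal (norm (u - w))"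
        unfolding set_distance_def by (intro Inf_lower) force
      with \<delta> have "\<delta> \<le> norm (u - w)"
        by (metis ereal_less_eq(3) less_imp_le order_trans)
      then have "\<delta>\<^sup>2 \<le> (norm (u - w))\<^sup>2"
        using \<delta>(1) by (intro power_mono) auto
      then show "u \<bullet> w \<le> 1 - \<delta>\<^sup>2 / 2"
        using uw by (simp add: dot_norm_neg field_simps)
    qed
  next
    case iv
    let ?S = "{ereal (norm (x + y) / (norm x + norm y)) | x y. x \<in> K1 \<and> y \<in> K2 \<and> (x, y) \<noteq> (0, 0)}"
    obtain \<delta> where \<delta>: "0 < ereal \<delta>" "ereal \<delta> < Inf ?S"
      using ereal_dense2[OF iv] by blast
    show ?thesis
    proof (rule closed_sum_if_norm_bound)
      show "0 < \<delta>"
        using \<delta>(1) by simp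
      fix x y assume xy: "x \<in> K1" "y \<in> K2"
      show "\<delta> * norm x \<le> norm (x + y)"
      proof (cases "x = 0")
        case False
        with xy have "Inf ?S \<le> ereal (norm (x + y) / (norm x + norm y))"
          by (intro Inf_lower) blast
        with \<delta>(2) have "ereal \<delta> \<le> ereal (norm (x + y) / (norm x + norm y))"
          by order
        then have "\<delta> * (norm x + norm y) \<le> norm (x + y)"
          using False by (simp add: pos_le_divide_eq add_pos_nonneg)
        moreover have "\<delta> * norm x \<le> \<delta> * (norm x + norm y)"
          using \<delta>(1) by (intro mult_left_mono) auto
        ultimately show ?thesis
          by linarith
      qed auto
    qed (use cc in auto)
  next
    case v
    from v(2) show ?thesis
    proof
      assume "K1 \<subseteq> V"
      then show ?thesis
        using closed_sum_if_finite_dim[OF K1 K2 v(1)] v(3) by (simp add: N_def)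
    next
      assume "K2 \<subseteq> V"
      \<comment> \<open>With the roles of the cones exchanged, the trivial intersection carries over
        by reflection through the origin.\<close>
      moreover have "K2 \<inter> uminus ` K1 = uminus ` (K1 \<inter> N)"
        by (force simp: N_def)
      ultimately have "closed (K2 + K1)"
        using closed_sum_if_finite_dim[OF K2 K1 v(1)] v(3) by simp
      then show ?thesis
        by (simp add: add.commute)
    qed
  qed
qed

end
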